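(* Let $P,Q\in\mathbb Z$ with $Q=\pm1$ and $\Delta=P^2+4Q>0$, and assume the Lucas sequence $U_n=U_n(P,Q)$ is nondegenerate. For $A\in\mathbb Z\setminus\{0\}$ let $$Z_A=\{z(p):p\mid A\text{ a rational prime for which } z(p)\text{ exists}\}.$$ There exists a constant $N_0=N_0(P,Q)$, depending only on $P,Q$, such that the following holds. Suppose that $n>N_0$, $n\notin Z_A$, and $n$ occurs as one of the indices $n_1,\dots,n_r$ in a coprime product solution $$Ay^2=\prod_{i=1}^r U_{n_i}(P,Q),\qquad y\in\mathbb Z,\quad \gcd(n_i,n_j)=1\ (i\ne j),$$ with $n_1,\dots,n_r$ positive integers. Then $U_n$ has a primitive prime divisor $p\nmid A$, and every primitive prime divisor $p\nmid A$ of $U_n$ satisfies $v_p(U_n)\ge2$.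
   Context: The Lucas sequence $U_n=U_n(P,Q)$ is defined by $U_0=0$, $U_1=1$, $U_{n+2}=PU_{n+1}+QU_n$. Let $\alpha,\beta$ be the roots of $x^2-Px-Q$. The sequence is nondegenerate if $\alpha/\beta$ is not a root of unity (then $U_n\neq0$ for $n\ge1$). A rational prime $p$ is a primitive prime divisor of $U_n$ if $p\mid U_n$ and $p\nmid U_m$ for all $1\le m<n$. For a rational prime $p$ dividing some $U_n$ with $n\ge1$, $z(p)=\min\{n\ge1:p\mid U_n\}$ (rank of apparition). $v_p$ is the $p$-adic valuation. *)

theory Defs
  imports Complex_Main "HOL-Computational_Algebra.Computational_Algebra"
begin

fun lucas_U :: "int \<Rightarrow> int \<Rightarrow> nat \<Rightarrow> int" where
  "lucas_U P Q 0 = 0"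
| "lucas_U P Q (Suc 0) = 1"
| "lucas_U P Q (Suc (Suc n)) = P * lucas_U P Q (Suc n) + Q * lucas_U P Q n"

text \<open>The roots of \<open>x^2 - P x - Q\<close>, listed with multiplicity.\<close>

definition lucas_roots :: "int \<Rightarrow> int \<Rightarrow> complex \<Rightarrow> complex \<Rightarrow> bool" where
  "lucas_roots P Q \<alpha> \<beta> \<longleftrightarrow>
     [:- of_int Q, - of_int P, 1:] = [:- \<alpha>, 1:] * [:- \<beta>, 1:]"

definition root_of_unity :: "complex \<Rightarrow> bool" where
  "root_of_unity x \<longleftrightarrow> (\<exists>k\<ge>1. x ^ k = 1)"

text \<open>Both orderings of the two roots are quantified over, which is harmless since being a root
  of unity is invariant under inversion. The definition is meant for \<open>Q \<noteq> 0\<close>, so that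
  both roots are nonzero.\<close>

definition lucas_nondegenerate :: "int \<Rightarrow> int \<Rightarrow> bool" where
  "lucas_nondegenerate P Q \<longleftrightarrow>
     (\<forall>\<alpha> \<beta>. lucas_roots P Q \<alpha> \<beta> \<longrightarrow> \<not> root_of_unity (\<alpha> / \<beta>))"

definition primitive_prime_divisor :: "int \<Rightarrow> int \<Rightarrow> nat \<Rightarrow> int \<Rightarrow> bool" where
  "primitive_prime_divisor P Q n p \<longleftrightarrow>
     prime p \<and> p dvd lucas_U P Q n \<and> (\<forall>m. 1 \<le> m \<and> m < n \<longrightarrow> \<not> p dvd lucas_U P Q m)"

definition has_rank :: "int \<Rightarrow> int \<Rightarrow> int \<Rightarrow> bool" where
  "has_rank P Q p \<longleftrightarrow> (\<exists>n\<ge>1. p dvd lucas_U P Q n)"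

text \<open>Only meaningful under \<^const>\<open>has_rank\<close>.\<close>

definition rank_of_apparition :: "int \<Rightarrow> int \<Rightarrow> int \<Rightarrow> nat" where
  "rank_of_apparition P Q p = (LEAST n. n \<ge> 1 \<and> p dvd lucas_U P Q n)"

definition Z_set :: "int \<Rightarrow> int \<Rightarrow> int \<Rightarrow> nat set" where
  "Z_set P Q A = {rank_of_apparition P Q p | p. prime p \<and> p dvd A \<and> has_rank P Q p}"

text \<open>The list \<open>ns\<close> holds the indices \<open>n_1, ..., n_r\<close>. Coprimality is required for distinct
  positions, so the value 1 may be repeated.\<close>

definition coprime_product_solution :: "int \<Rightarrow> int \<Rightarrow> int \<Rightarrow> int \<Rightarrow> nat list \<Rightarrow> bool" where
  "coprime_product_solution P Q A y ns \<longleftrightarrow>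
     A * y ^ 2 = (\<Prod>i<length ns. lucas_U P Q (ns ! i)) \<and>
     (\<forall>i<length ns. ns ! i > 0) \<and>
     (\<forall>i<length ns. \<forall>j<length ns. i \<noteq> j \<longrightarrow> gcd (ns ! i) (ns ! j) = 1)"

end

theory Submission imports Defs "HOL-Real_Asymp.Real_Asymp" begin

text \<open>
  The substance of the theorem is that \<open>U\<^sub>n\<close> has a primitive prime divisor once \<open>n\<close> is large.
  Given this, a primitive prime divisor \<open>p\<close> of \<open>U\<^sub>n\<close> has rank \<open>n\<close>, so \<open>n \<notin> Z\<^sub>A\<close> gives \<open>p \<nmid> A\<close>. In a
  coprime product solution \<open>p\<close> divides no factor other than \<open>U\<^sub>n\<close>, because the gcd of two Lucas
  numbers with coprime indices is \<open>1\<close>. Comparing valuations in \<open>A y\<^sup>2 = \<Prod> U\<^bsub>n\<^sub>i\<^esub>\<close> shows that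
  \<open>v\<^sub>p(U\<^sub>n) = 2 v\<^sub>p(y)\<close> is even and positive, hence at least \<open>2\<close>.

  Primitive divisors are produced by a sieve that uses only the divisibility properties of \<open>U\<close>, and
  no cyclotomic polynomials. For a set \<open>K\<close> of primes dividing \<open>n\<close>, let \<open>M\<^sub>K(n)\<close> (\<open>new_mass\<close>) be the sum of
  \<open>v\<^sub>p(U\<^sub>n) log p\<close> over those primes \<open>p\<close> that divide \<open>U\<^sub>n\<close> but divide \<open>U\<^bsub>n/q\<^esub>\<close> for no \<open>q \<in> K\<close>. If \<open>K\<close>
  consists of all prime factors of \<open>n\<close>, every \<open>p\<close> that occurs is primitive, so it suffices to show
  \<open>M\<^sub>K(n) > 0\<close>. Binet's formula gives \<open>M\<^sub>\<emptyset>(n) = log |U\<^sub>n| = n log |\<alpha>| + O(1)\<close>. Moreover, if \<open>p\<close>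
  divides \<open>U\<^sub>m\<close>, then \<open>v\<^sub>p(U\<^bsub>mq\<^esub>)\<close> equals \<open>v\<^sub>p(U\<^sub>m)\<close> for \<open>p \<noteq> q\<close> and exceeds it by at most \<open>1\<close> for
  \<open>p = q\<close> (by at most a constant for \<open>p = q = 2\<close>); this is \<open>multiplicity_U_step\<close>. Therefore, for \<open>q \<notin> K\<close>,
  \<open>M\<^bsub>K \<union> {q}\<^esub>(n) = M\<^sub>K(n) - M\<^sub>K(n/q) + O(1 + log q)\<close>, and induction on \<open>K\<close> yields
  \<open>M\<^sub>K(n) = n log |\<alpha>| \<Prod>\<^bsub>q \<in> K\<^esub> (1 - 1/q) + O(2\<^bsup>|K|\<^esup> (1 + log n))\<close>
  (\<open>new_mass_estimate\<close>).
  For the full set of prime factors, the main term is at least a constant times \<open>2\<^bsup>|K|\<^esup> \<surd>n\<close>, which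
  dominates the error (\<open>totient_product_lower_bound\<close>, \<open>eventually_primitive_prime_divisor\<close>). All constants depend on \<open>P\<close> and \<open>Q\<close> only.
\<close>

section \<open>Divisibility in the Lucas sequence\<close>

text \<open>The case \<open>P = 0\<close> of a positive discriminant is exactly the degenerate one, with \<open>\<alpha>/\<beta> = -1\<close>.\<close>

locale unit_lucas =
  fixes P Q :: int
  assumes Q_unit: "Q = 1 \<or> Q = -1"
    and disc_pos: "P ^ 2 + 4 * Q > 0"
    and P_nonzero: "P \<noteq> 0"
begin

abbreviation U :: "nat \<Rightarrow> int" where "U \<equiv> lucas_U P Q"

lemma U_add: "U (m + n) = U m * U (Suc n) + U (Suc m) * U n - P * U m * U n"
proof (induction m rule: induct_nat_012)
  case (ge2 m)
  have "U (Suc (Suc m) + n) = P * U (Suc m + n) + Q * U (m + n)" by simp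
  then show ?case unfolding ge2 by (simp add: algebra_simps)
qed simp_all

lemma U_dvd_U_mult: "U m dvd U (m * k)"
proof (induction k)
  case (Suc k)
  have "U (m * Suc k) = U (m + m * k)" by simp
  then show ?case using Suc by (simp add: U_add)
qed simp

lemma U_dvd_U: "m dvd n \<Longrightarrow> U m dvd U n"
  using U_dvd_U_mult by (auto elim!: dvdE)

lemma coprime_U_Suc: "coprime (U n) (U (Suc n))"
proof (induction n)
  case (Suc n)
  have "coprime (U (Suc n)) (Q * U n)"
    using Suc Q_unit by (auto simp: coprime_commute)
  then show ?case
    using gcd_add_mult[of "U (Suc n)" P "Q * U n"] by (simp add: coprime_iff_gcd_eq_1)
qed simp

lemma prime_dvd_U_add_iff:
  assumes "prime p" "p dvd U m"
  shows "p dvd U (m + k) \<longleftrightarrow> p dvd U k"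
proof -
  have "\<not> p dvd U (Suc m)"
    using assms coprime_U_Suc[of m] by (meson coprime_common_divisor not_prime_unit)
  moreover have "p dvd U (m + k) \<longleftrightarrow> p dvd U (Suc m) * U k"
  proof -
    have "p dvd U m * U (Suc k) - P * U m * U k" using assms by simp
    moreover have "U (m + k) = (U m * U (Suc k) - P * U m * U k) + U (Suc m) * U k"
      by (simp add: U_add)
    ultimately show ?thesis by (metis dvd_add_right_iff)
  qed
  ultimately show ?thesis using assms by (simp add: prime_dvd_mult_iff)
qed

lemma prime_dvd_U_gcd:
  assumes "prime p" "p dvd U m" "p dvd U n"
  shows "p dvd U (gcd m n)"
  using assms(2,3)
proof (induction "m + n" arbitrary: m n rule: less_induct)
  case less
  consider "m = 0 \<or> n = 0" | "0 < m" "m \<le> n" | "0 < n" "n \<le> m" by linarith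
  then show ?case
  proof cases
    case 2
    then obtain k where "n = m + k" using le_Suc_ex by blast
    then show ?thesis
      using less 2 prime_dvd_U_add_iff[OF assms(1), of m k] by simp
  next
    case 3
    then obtain k where k: "m = k + n" using le_Suc_ex add.commute by metis
    then have "p dvd U k"
      using less.prems prime_dvd_U_add_iff[OF assms(1), of n k] by (simp add: add.commute)
    then show ?thesis using less.hyps[of k n] less.prems 3 k by simp
  qed (use less in auto)
qed

text \<open>
  In the ring generated by a root \<open>\<theta>\<close> of \<open>t\<^sup>2 - P t - Q\<close> one has \<open>\<theta>\<^sup>m = x \<theta> + c\<close> with the \<open>x\<close> and \<open>c\<close>
  below. The statement reads off the coefficient of \<open>\<theta>\<close> in \<open>(x \<theta> + c)\<^sup>k\<close> modulo \<open>x\<^sup>3\<close>; the factor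
  \<open>c\<^sup>2\<close> avoids the truncated exponents \<open>k - 1\<close> and \<open>k - 2\<close>.
\<close>

lemma U_mult_expansion:
  fixes m k :: nat
  defines "x \<equiv> U m" and "c \<equiv> U (Suc m) - P * U m"
  shows "x ^ 3 dvd c\<^sup>2 * U (m * k) -
           (of_nat k * c ^ Suc k * x + of_nat (k choose 2) * x\<^sup>2 * P * c ^ k)"
proof -
  \<comment> \<open>The constant coefficient of \<open>\<theta>\<close> to the power \<open>m j\<close>.\<close>
  define b where "b j = U (Suc (m * j)) - P * U (m * j)" for j
  have U_rec: "U (m * Suc j) = (P * x + c) * U (m * j) + x * b j" for j
    using U_add[of m "m * j"] by (simp add: x_def c_def b_def algebra_simps)
  have b_rec: "b (Suc j) = Q * x * U (m * j) + c * b j" for j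
  proof -
    have "U (Suc (m + m * j)) = U (Suc m) * U (Suc (m * j)) + Q * U m * U (m * j)"
      using U_add[of "Suc m" "m * j"] by (simp add: algebra_simps)
    then show ?thesis
      unfolding b_def mult_Suc_right U_add[of m "m * j"] x_def c_def by (simp add: algebra_simps)
  qed
  have b_cong: "x\<^sup>2 dvd b j - c ^ j" for j
  proof (induction j)
    case (Suc j)
    have "x\<^sup>2 dvd x * U (m * j)"
      using U_dvd_U_mult[of m j] by (simp add: x_def power2_eq_square)
    then have "x\<^sup>2 dvd Q * (x * U (m * j)) + c * (b j - c ^ j)" using Suc by simp
    then show ?case by (simp add: b_rec algebra_simps)
  qed (simp add: b_def)
  show ?thesis
  proof (induction k)
    case (Suc k)
    define D where "D = c\<^sup>2 * U (m * k) -
      (of_nat k * c ^ Suc k * x + of_nat (k choose 2) * x\<^sup>2 * P * c ^ k)"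
    have choose: "int (Suc k choose 2) = int (k choose 2) + int k"
      by (simp add: numeral_2_eq_2)
    have "c\<^sup>2 * U (m * Suc k) -
        (of_nat (Suc k) * c ^ Suc (Suc k) * x + of_nat (Suc k choose 2) * x\<^sup>2 * P * c ^ Suc k)
      = (P * x + c) * D + x * c\<^sup>2 * (b k - c ^ k) + x ^ 3 * (int (k choose 2) * P\<^sup>2 * c ^ k)"
      unfolding U_rec choose D_def by (simp add: algebra_simps power2_eq_square power3_eq_cube)
    moreover have "x ^ 3 dvd (P * x + c) * D" using Suc by (simp add: D_def)
    moreover have "x ^ 3 dvd x * c\<^sup>2 * (b k - c ^ k)"
      using mult_dvd_mono[OF dvd_refl[of x] dvd_mult[OF b_cong[of k], of "c\<^sup>2"]]
      by (simp add: power2_eq_square power3_eq_cube mult.assoc)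
    ultimately show ?case by simp
  qed (simp add: numeral_2_eq_2)
qed

section \<open>Binet's formula and the size of the terms\<close>

text \<open>The real roots of \<open>t\<^sup>2 - P t - Q\<close>; the sign of \<open>P\<close> makes \<open>alpha\<close> the one of larger absolute value.\<close>

definition alpha :: real where "alpha = (P + sgn P * sqrt (P\<^sup>2 + 4 * Q)) / 2"
definition beta :: real where "beta = (P - sgn P * sqrt (P\<^sup>2 + 4 * Q)) / 2"

lemma alpha_beta_sum: "alpha + beta = P" and alpha_beta_mult: "alpha * beta = - Q"
  and beta_less_alpha: "\<bar>beta\<bar> < \<bar>alpha\<bar>"
proof -
  define s where "s = sqrt (P\<^sup>2 + 4 * Q)"
  have d: "real_of_int (P\<^sup>2 + 4 * Q) > 0" using disc_pos by linarith
  then have s: "s\<^sup>2 = P\<^sup>2 + 4 * Q" "s > 0" by (simp_all add: s_def)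
  show "alpha + beta = P" by (simp add: alpha_def beta_def field_simps)
  have "(sgn P)\<^sup>2 = 1" using P_nonzero by (simp add: sgn_if)
  then have "(real_of_int (sgn P))\<^sup>2 = 1" by (metis of_int_1 of_int_power)
  then have "(sgn P * s)\<^sup>2 = P\<^sup>2 + 4 * Q" using s by (simp add: power_mult_distrib)
  moreover have "4 * (alpha * beta) = P\<^sup>2 - (sgn P * s)\<^sup>2"
    unfolding alpha_def beta_def s_def[symmetric] by (simp add: field_simps power2_eq_square)
  ultimately show "alpha * beta = - Q" by simp
  show "\<bar>beta\<bar> < \<bar>alpha\<bar>"
  proof (cases "P > 0")
    case True
    then have "real_of_int P > 0" "sgn P = 1" by simp_all
    then have "\<bar>P - sgn P * s\<bar> < \<bar>P + sgn P * s\<bar>" using s(2) by (auto simp: abs_if)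
    then show ?thesis unfolding alpha_def beta_def s_def[symmetric] by simp
  next
    case False
    then have "real_of_int P < 0" "sgn P = -1" using P_nonzero by simp_all
    then have "\<bar>P - sgn P * s\<bar> < \<bar>P + sgn P * s\<bar>" using s(2) by (auto simp: abs_if)
    then show ?thesis unfolding alpha_def beta_def s_def[symmetric] by simp
  qed
qed

lemma abs_alpha_mult: "\<bar>alpha\<bar> * \<bar>beta\<bar> = 1"
  using Q_unit alpha_beta_mult by (metis abs_1 abs_minus_cancel abs_mult of_int_1 of_int_minus)

lemma abs_alpha_gt_1: "\<bar>alpha\<bar> > 1"
proof (rule ccontr)
  assume "\<not> \<bar>alpha\<bar> > 1"
  then have "\<bar>alpha\<bar> * \<bar>beta\<bar> \<le> 1 * \<bar>beta\<bar>" by (intro mult_right_mono) auto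
  moreover have "\<bar>beta\<bar> < 1" using \<open>\<not> \<bar>alpha\<bar> > 1\<close> beta_less_alpha by linarith
  ultimately show False using abs_alpha_mult by simp
qed

lemma binet: "(alpha - beta) * U n = alpha ^ n - beta ^ n"
proof -
  have a: "alpha\<^sup>2 = P * alpha + Q" and b: "beta\<^sup>2 = P * beta + Q"
    using alpha_beta_sum alpha_beta_mult by (simp_all add: power2_eq_square algebra_simps flip: alpha_beta_sum)
  have "(alpha - beta) * U n = alpha ^ n - beta ^ n
      \<and> (alpha - beta) * U (Suc n) = alpha ^ Suc n - beta ^ Suc n"
  proof (induction n)
    case (Suc n)
    have "(alpha - beta) * U (Suc (Suc n))
        = P * ((alpha - beta) * U (Suc n)) + Q * ((alpha - beta) * U n)"
      by (simp add: algebra_simps)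
    also have "\<dots> = (P * alpha + Q) * alpha ^ n - (P * beta + Q) * beta ^ n"
      unfolding conjunct1[OF Suc] conjunct2[OF Suc] by (simp add: algebra_simps)
    also have "\<dots> = alpha ^ Suc (Suc n) - beta ^ Suc (Suc n)"
      by (simp add: a[symmetric] b[symmetric] power2_eq_square)
    finally show ?case using Suc by simp
  qed simp
  then show ?thesis by simp
qed

lemma U_nonzero: "n > 0 \<Longrightarrow> U n \<noteq> 0"
proof
  assume n: "n > 0" and "U n = 0"
  then have "\<bar>alpha\<bar> ^ n = \<bar>beta\<bar> ^ n" using binet[of n] by (simp flip: power_abs)
  moreover have "\<bar>beta\<bar> ^ n < \<bar>alpha\<bar> ^ n"
    using n beta_less_alpha by (intro power_strict_mono) auto
  ultimately show False by simp
qed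

lemma ln_abs_U: "\<exists>C\<ge>0. \<forall>n>0. abs (ln (abs (real_of_int (U n))) - real n * ln (abs alpha)) \<le> C"
proof -
  define r where "r = \<bar>beta\<bar> / \<bar>alpha\<bar>"
  define d where "d = \<bar>alpha - beta\<bar>"
  have a0: "\<bar>alpha\<bar> > 0" using abs_alpha_gt_1 by simp
  have r: "0 \<le> r" "r < 1" using beta_less_alpha a0 by (simp_all add: r_def)
  have d: "d > 0" using beta_less_alpha by (auto simp: d_def)
  have "\<bar>ln \<bar>real_of_int (U n)\<bar> - n * ln \<bar>alpha\<bar>\<bar> \<le> \<bar>ln (1 - r)\<bar> + ln 2 + \<bar>ln d\<bar>" if n: "n > 0" for n
  proof -
    define w where "w = 1 - (beta / alpha) ^ n"
    have "\<bar>(beta / alpha) ^ n\<bar> = r ^ n" by (simp add: power_abs r_def)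
    moreover have "r ^ n \<le> r" using r n power_decreasing[of 1 n r] by simp
    ultimately have w: "1 - r \<le> \<bar>w\<bar>" "\<bar>w\<bar> \<le> 2" using r by (auto simp: w_def)
    then have "w \<noteq> 0" using r by auto
    have "d * \<bar>U n\<bar> = \<bar>alpha\<bar> ^ n * \<bar>w\<bar>"
      using arg_cong[OF binet[of n], of abs] a0
      by (simp add: d_def w_def abs_mult power_divide right_diff_distrib flip: power_abs)
        (simp add: field_simps flip: abs_mult)
    then have "ln d + ln \<bar>real_of_int (U n)\<bar> = n * ln \<bar>alpha\<bar> + ln \<bar>w\<bar>"
      using d a0 \<open>w \<noteq> 0\<close> U_nonzero[OF n] ln_mult[of d "\<bar>real_of_int (U n)\<bar>"]
        ln_mult[of "\<bar>alpha\<bar> ^ n" "\<bar>w\<bar>"] by (simp add: ln_realpow)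
    moreover have "ln (1 - r) \<le> ln \<bar>w\<bar>" "ln \<bar>w\<bar> \<le> ln 2" using w r by simp_all
    moreover have "ln (2 :: real) \<ge> 0" by simp
    ultimately show ?thesis
      using abs_ge_self[of "ln d"] abs_ge_minus_self[of "ln d"] abs_ge_minus_self[of "ln (1 - r)"]
      by (intro abs_leI) linarith+
  qed
  moreover have "\<bar>ln (1 - r)\<bar> + ln 2 + \<bar>ln d\<bar> \<ge> 0" by simp
  ultimately show ?thesis by blast
qed


section \<open>Valuations along multiples of an index\<close>

text \<open>The congruence of \<open>U_mult_expansion\<close> divided by \<open>U m\<close>, with \<open>R = U (m * k) / U m\<close>.\<close>

lemma U_quotient_cong:
  fixes m k :: nat
  defines "c \<equiv> U (Suc m) - P * U m"
  assumes "m > 0" "U (m * k) = U m * R"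
  shows "(U m)\<^sup>2 dvd c\<^sup>2 * R - (of_nat k * c ^ Suc k + of_nat (k choose 2) * U m * P * c ^ k)"
proof -
  have "c\<^sup>2 * U (m * k) - (of_nat k * c ^ Suc k * U m + of_nat (k choose 2) * (U m)\<^sup>2 * P * c ^ k)
      = U m * (c\<^sup>2 * R - (of_nat k * c ^ Suc k + of_nat (k choose 2) * U m * P * c ^ k))"
    unfolding assms(3) by (simp add: algebra_simps power2_eq_square)
  then have "U m * (U m)\<^sup>2 dvd
      U m * (c\<^sup>2 * R - (of_nat k * c ^ Suc k + of_nat (k choose 2) * U m * P * c ^ k))"
    using U_mult_expansion[of m k] by (simp add: c_def power3_eq_cube power2_eq_square mult.assoc)
  then show ?thesis using U_nonzero[OF assms(2)] by (simp only: dvd_mult_cancel_left) simp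
qed

lemma prime_not_dvd_U_shift:
  assumes "prime p" "p dvd U m"
  shows "\<not> p dvd U (Suc m) - P * U m"
proof
  assume "p dvd U (Suc m) - P * U m"
  then have "p dvd (U (Suc m) - P * U m) + P * U m" using assms by (intro dvd_add) auto
  then show False
    using assms coprime_U_Suc[of m] by (metis coprime_common_divisor diff_add_cancel not_prime_unit)
qed

lemma multiplicity_U_mult_coprime:
  assumes p: "prime p" "p dvd U m" and "m > 0" "k > 0" and pk: "\<not> p dvd int k"
  shows "multiplicity p (U (m * k)) = multiplicity p (U m)"
proof -
  define c where "c = U (Suc m) - P * U m"
  obtain R where R: "U (m * k) = U m * R" using U_dvd_U_mult by (meson dvdE)
  have nz: "U m \<noteq> 0" "R \<noteq> 0" using U_nonzero[of m] U_nonzero[of "m * k"] R assms by auto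
  have "\<not> p dvd R"
  proof
    assume "p dvd R"
    define T where "T = of_nat (k choose 2) * U m * P * c ^ k"
    have "p dvd (U m)\<^sup>2" using p by (simp add: power2_eq_square)
    then have "p dvd c\<^sup>2 * R - (of_nat k * c ^ Suc k + T)"
      using U_quotient_cong[OF \<open>m > 0\<close> R] by (auto simp: c_def T_def intro: dvd_trans)
    moreover have "p dvd c\<^sup>2 * R - T" using \<open>p dvd R\<close> p by (simp add: T_def)
    ultimately have "p dvd (c\<^sup>2 * R - T) - (c\<^sup>2 * R - (of_nat k * c ^ Suc k + T))"
      by (rule dvd_diff[rotated])
    then have "p dvd of_nat k * c ^ Suc k" by simp
    then have "p dvd c" using p pk by (metis prime_dvd_mult_iff prime_dvd_power)
    then show False using prime_not_dvd_U_shift[OF p] by (simp add: c_def)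
  qed
  then show ?thesis
    using prime_elem_multiplicity_mult_distrib[OF prime_imp_prime_elem[OF p(1)] nz]
    by (simp add: R not_dvd_imp_multiplicity_0)
qed

text \<open>
  The side condition makes \<open>(q choose 2) * U m\<close> divisible by \<open>q\<^sup>2\<close>, so that the quotient
  \<open>U (m * q) / U m\<close> is congruent modulo \<open>q\<^sup>2\<close> to \<open>q\<close> times a number prime to \<open>q\<close>.
\<close>

lemma multiplicity_U_mult_self:
  assumes q: "prime q" "int q dvd U m" and "m > 0" and q4: "odd q \<or> 4 dvd U m"
  shows "multiplicity (int q) (U (m * q)) \<le> multiplicity (int q) (U m) + 1"
proof -
  define c where "c = U (Suc m) - P * U m"
  have p: "prime (int q)" using q by simp
  have "q > 0" using q prime_gt_0_nat by blast
  obtain R where R: "U (m * q) = U m * R" using U_dvd_U_mult by (meson dvdE)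
  have nz: "U m \<noteq> 0" "R \<noteq> 0" using U_nonzero[of m] U_nonzero[of "m * q"] R \<open>m > 0\<close> \<open>q > 0\<close> by auto
  have "\<not> (int q)\<^sup>2 dvd R"
  proof
    assume "(int q)\<^sup>2 dvd R"
    define T where "T = of_nat (q choose 2) * U m * P * c ^ q"
    have "(int q)\<^sup>2 dvd of_nat (q choose 2) * U m"
    proof (cases "odd q")
      case True
      then have "q > 2" using q(1) prime_ge_2_nat[of q] by (cases "q = 2") auto
      then have "int q dvd of_nat (q choose 2)" using q(1) dvd_choose_prime[of 2 q] by simp
      then show ?thesis using q(2) by (simp add: power2_eq_square mult_dvd_mono)
    next
      case False
      then have "q = 2" using q(1) prime_odd_nat[of q] prime_ge_2_nat[of q] by linarith
      then show ?thesis using q4 by simp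
    qed
    then have "(int q)\<^sup>2 dvd T" by (simp add: T_def)
    have "(int q)\<^sup>2 dvd (U m)\<^sup>2" using q by simp
    then have "(int q)\<^sup>2 dvd c\<^sup>2 * R - (of_nat q * c ^ Suc q + T)"
      using U_quotient_cong[OF \<open>m > 0\<close> R] by (auto simp: c_def T_def intro: dvd_trans)
    moreover have "(int q)\<^sup>2 dvd c\<^sup>2 * R - T"
      using \<open>(int q)\<^sup>2 dvd R\<close> \<open>(int q)\<^sup>2 dvd T\<close> by simp
    ultimately have "(int q)\<^sup>2 dvd (c\<^sup>2 * R - T) - (c\<^sup>2 * R - (of_nat q * c ^ Suc q + T))"
      by (rule dvd_diff[rotated])
    then have "int q * int q dvd int q * c ^ Suc q" by (simp add: power2_eq_square)
    then have "int q dvd c ^ Suc q" using \<open>q > 0\<close> by (simp only: dvd_mult_cancel_left) simp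
    then have "int q dvd c" using p prime_dvd_power by blast
    then show False using prime_not_dvd_U_shift[OF p q(2)] by (simp add: c_def)
  qed
  then have "multiplicity (int q) R < 2"
    using nz q(1) prime_gt_1_nat[of q] power_dvd_iff_le_multiplicity[of R "int q" 2] by auto
  then show ?thesis using nz p by (simp add: R prime_elem_multiplicity_mult_distrib)
qed

text \<open>
  If some term is even, let \<open>z\<close> be the rank of apparition of \<open>2\<close> and \<open>m = z k\<close>. For even \<open>k\<close> the previous lemma applies
  since \<open>4\<close> divides \<open>U m\<close>; for odd \<open>k\<close> the valuation of \<open>U (2 m)\<close> is that of \<open>U (2 z)\<close>, a constant.
\<close>

lemma multiplicity_2_U_double:
  "\<exists>c. \<forall>m>0. 2 dvd U m \<longrightarrow> multiplicity 2 (U (m * 2)) \<le> multiplicity 2 (U m) + 1 + c"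
proof (cases "\<exists>z>0. 2 dvd U z")
  case True
  define z where "z = (LEAST z. z > 0 \<and> 2 dvd U z)"
  have z: "z > 0" "2 dvd U z" and z_least: "\<And>k. k > 0 \<Longrightarrow> 2 dvd U k \<Longrightarrow> z \<le> k"
    using LeastI_ex[OF True] unfolding z_def by (auto intro: Least_le)
  have "multiplicity 2 (U (m * 2)) \<le> multiplicity 2 (U m) + 1 + multiplicity 2 (U (z * 2))"
    if m: "m > 0" "2 dvd U m" for m
  proof -
    have "z \<le> gcd z m" using z m by (intro z_least prime_dvd_U_gcd) auto
    then have "gcd z m = z" using gcd_le1_nat[of z m] z by linarith
    then obtain k where k: "m = z * k" by (metis dvdE gcd_dvd2)
    show ?thesis
    proof (cases "even k")
      case True
      have "U (z * 2) = U z * (2 * U (Suc z) - P * U z)"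
        using U_add[of z z] by (simp add: algebra_simps mult_2_right)
      then have "2 * 2 dvd U (z * 2)" using z(2) by (metis dvd_diff dvd_mult dvd_triv_left mult_dvd_mono)
      moreover have "U (z * 2) dvd U m" using True k by (intro U_dvd_U) auto
      ultimately have "4 dvd U m" using dvd_trans by fastforce
      then show ?thesis using multiplicity_U_mult_self[of 2 m] m by simp
    next
      case False
      then have "k > 0" by (cases k) auto
      have "2 dvd U (z * 2)" using z(2) U_dvd_U_mult dvd_trans by blast
      then have "multiplicity 2 (U (z * 2 * k)) = multiplicity 2 (U (z * 2))"
        using z False \<open>k > 0\<close> by (intro multiplicity_U_mult_coprime) auto
      then show ?thesis by (simp add: k mult_ac)
    qed
  qed
  then show ?thesis by blast
qed blast

lemma multiplicity_U_step:
  "\<exists>C\<ge>0. \<forall>m q p. m > 0 \<longrightarrow> prime q \<longrightarrow> prime p \<longrightarrow> p dvd U m \<longrightarrow>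
     multiplicity p (U (m * q)) * ln (real_of_int p) \<le>
       multiplicity p (U m) * ln (real_of_int p) + (if p = int q then ln (real q) + C else 0)"
proof -
  obtain c where c: "\<And>m. m > 0 \<Longrightarrow> 2 dvd U m \<Longrightarrow>
      multiplicity 2 (U (m * 2)) \<le> multiplicity 2 (U m) + 1 + c"
    using multiplicity_2_U_double by blast
  have "multiplicity p (U (m * q)) * ln (real_of_int p) \<le>
      multiplicity p (U m) * ln (real_of_int p) + (if p = int q then ln (real q) + c * ln 2 else 0)"
    if h: "m > 0" "prime q" "prime p" "p dvd U m" for m q p
  proof (cases "p = int q")
    case False
    then have "\<not> p dvd int q" using h by (meson primes_dvd_imp_eq prime_int_nat_transfer prime_nat_int_transfer)
    then show ?thesis
      using False h prime_gt_0_nat[of q] multiplicity_U_mult_coprime[of p m q] by simp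
  next
    case True
    have q2: "q \<ge> 2" using h prime_ge_2_nat by blast
    show ?thesis
    proof (cases "q = 2")
      case q: True
      have "real (multiplicity 2 (U (m * 2))) \<le> multiplicity 2 (U m) + 1 + c"
        using c[of m] h True q by (simp flip: of_nat_add of_nat_Suc)
      then have "multiplicity 2 (U (m * 2)) * ln (2 :: real) \<le> (multiplicity 2 (U m) + 1 + c) * ln 2"
        by (intro mult_right_mono) auto
      then show ?thesis using True q by (simp add: algebra_simps)
    next
      case False
      then have "odd q" using h(2) q2 by (intro prime_odd_nat) auto
      then have "real (multiplicity (int q) (U (m * q))) \<le> multiplicity (int q) (U m) + 1"
        using multiplicity_U_mult_self[of q m] h True by (simp flip: of_nat_add of_nat_Suc)
      then have "multiplicity (int q) (U (m * q)) * ln (real q) \<le> (multiplicity (int q) (U m) + 1) * ln q"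
        using q2 by (intro mult_right_mono) auto
      moreover have "0 \<le> c * ln (2 :: real)" by simp
      ultimately have "multiplicity (int q) (U (m * q)) * ln (real q) \<le>
          multiplicity (int q) (U m) * ln (real q) + (ln (real q) + c * ln 2)"
        unfolding distrib_right of_nat_add of_nat_1 by linarith
      then show ?thesis using True by simp
    qed
  qed
  moreover have "c * ln (2 :: real) \<ge> 0" by simp
  ultimately show ?thesis by blast
qed

section \<open>Sieving out the non-primitive primes\<close>

text \<open>The prime divisors of \<open>U n\<close> that divide \<open>U (n div q)\<close> for no \<open>q \<in> K\<close>. It is used for sets \<open>K\<close> of
  prime divisors of \<open>n\<close>, where the division is exact.\<close>

definition new_primes :: "nat set \<Rightarrow> nat \<Rightarrow> int set" where
  "new_primes K n = {p \<in> prime_factors (U n). \<forall>q\<in>K. \<not> p dvd U (n div q)}"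

text \<open>The logarithm of the part of \<open>\<bar>U n\<bar>\<close> composed of the primes in \<open>new_primes K n\<close>.\<close>

definition new_mass :: "nat set \<Rightarrow> nat \<Rightarrow> real" where
  "new_mass K n = (\<Sum>p\<in>new_primes K n. multiplicity p (U n) * ln (real_of_int p))"

lemma finite_new_primes [simp]: "finite (new_primes K n)"
  by (simp add: new_primes_def)

lemma new_mass_empty:
  assumes "n > 0"
  shows "new_mass {} n = ln (abs (real_of_int (U n)))"
proof -
  have "\<bar>U n\<bar> = (\<Prod>p\<in>prime_factors (U n). p ^ multiplicity p (U n))"
    using prod_prime_factors[of "U n"] U_nonzero[OF assms] by simp
  then have "abs (real_of_int (U n)) = (\<Prod>p\<in>prime_factors (U n). real_of_int p ^ multiplicity p (U n))"
    by (simp flip: of_int_abs)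
  moreover have "real_of_int p > 0" if "p \<in> prime_factors (U n)" for p
    using that prime_gt_0_int[of p] by auto
  ultimately show ?thesis
    by (simp add: new_mass_def new_primes_def ln_prod ln_realpow)
qed

text \<open>
  The primes removed by adding \<open>q\<close> to the sieve are those already new for \<open>K\<close> at \<open>m\<close>: for \<open>r \<in> K\<close>,
  a prime dividing both \<open>U m\<close> and \<open>U (m q / r)\<close> divides \<open>U (m / r)\<close>, as \<open>gcd m (m q / r) = m / r\<close>.
\<close>

lemma new_primes_split:
  assumes "m > 0" "prime q" "q \<notin> K" and K: "\<And>r. r \<in> K \<Longrightarrow> prime r \<and> r dvd m"
  shows "new_primes K (m * q) = new_primes (insert q K) (m * q) \<union> new_primes K m"
    and "new_primes (insert q K) (m * q) \<inter> new_primes K m = {}"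
proof -
  have q: "q > 0" using assms prime_gt_0_nat by blast
  have nz: "U m \<noteq> 0" "U (m * q) \<noteq> 0" using U_nonzero assms q by auto
  have "p dvd U (m * q div r) \<longleftrightarrow> p dvd U (m div r)" if p: "prime p" "p dvd U m" and r: "r \<in> K" for p r
  proof -
    obtain t where t: "m = r * t" using K r by blast
    have r0: "r > 0" using K r prime_gt_0_nat by blast
    have "coprime r q" using K r assms by (intro primes_coprime) auto
    then have "gcd (r * t) (t * q) = t"
      by (metis coprime_imp_gcd_eq_1 gcd_mult_distrib_nat mult.commute mult.right_neutral)
    then have "p dvd U (t * q) \<Longrightarrow> p dvd U t"
      using prime_dvd_U_gcd[of p "r * t" "t * q"] p t by simp
    moreover have "p dvd U t \<Longrightarrow> p dvd U (t * q)" using U_dvd_U_mult dvd_trans by blast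
    ultimately show ?thesis using r0 by (auto simp: t mult.assoc)
  qed
  moreover have "p dvd U (m * q)" if "p dvd U m" for p using that U_dvd_U_mult dvd_trans by blast
  ultimately show "new_primes K (m * q) = new_primes (insert q K) (m * q) \<union> new_primes K m"
    "new_primes (insert q K) (m * q) \<inter> new_primes K m = {}"
    using nz q by (auto simp: new_primes_def in_prime_factors_iff)
qed

lemma new_mass_step:
  "\<exists>C\<ge>0. \<forall>K m q. m > 0 \<longrightarrow> prime q \<longrightarrow> q \<notin> K \<longrightarrow> (\<forall>r\<in>K. prime r \<and> r dvd m) \<longrightarrow>
     new_mass K m \<le> new_mass K (m * q) - new_mass (insert q K) (m * q) \<and>
     new_mass K (m * q) - new_mass (insert q K) (m * q) \<le> new_mass K m + ln (real q) + C"
proof -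
  obtain C where "C \<ge> 0" and C: "\<And>m q p. m > 0 \<Longrightarrow> prime q \<Longrightarrow> prime p \<Longrightarrow> p dvd U m \<Longrightarrow>
     multiplicity p (U (m * q)) * ln (real_of_int p) \<le>
       multiplicity p (U m) * ln (real_of_int p) + (if p = int q then ln (real q) + C else 0)"
    using multiplicity_U_step by blast
  have "new_mass K m \<le> new_mass K (m * q) - new_mass (insert q K) (m * q) \<and>
     new_mass K (m * q) - new_mass (insert q K) (m * q) \<le> new_mass K m + ln (real q) + C"
    if h: "m > 0" "prime q" "q \<notin> K" "\<forall>r\<in>K. prime r \<and> r dvd m" for K m q
  proof -
    have q: "q > 1" using h prime_gt_1_nat by blast
    have eq: "new_mass K (m * q) - new_mass (insert q K) (m * q)
        = (\<Sum>p\<in>new_primes K m. multiplicity p (U (m * q)) * ln (real_of_int p))"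
      unfolding new_mass_def using new_primes_split[of m q K] h by (simp add: sum.union_disjoint)
    have p: "prime p \<and> p dvd U m \<and> ln (real_of_int p) \<ge> 0" if "p \<in> new_primes K m" for p
      using that prime_gt_0_int[of p] by (auto simp: new_primes_def in_prime_factors_iff)
    have "multiplicity p (U m) \<le> multiplicity p (U (m * q))" for p
      using h q U_nonzero[of "m * q"] by (intro dvd_imp_multiplicity_le U_dvd_U_mult) auto
    then have "new_mass K m \<le> (\<Sum>p\<in>new_primes K m. multiplicity p (U (m * q)) * ln (real_of_int p))"
      unfolding new_mass_def using p by (intro sum_mono mult_right_mono) auto
    moreover have "(\<Sum>p\<in>new_primes K m. multiplicity p (U (m * q)) * ln (real_of_int p))
        \<le> (\<Sum>p\<in>new_primes K m. multiplicity p (U m) * ln (real_of_int p)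
              + (if p = int q then ln (real q) + C else 0))"
      using p C h by (intro sum_mono) auto
    moreover have "\<dots> \<le> new_mass K m + (ln (real q) + C)"
      using q \<open>C \<ge> 0\<close> by (simp add: new_mass_def sum.distrib)
    ultimately show ?thesis unfolding eq by simp
  qed
  with \<open>C \<ge> 0\<close> show ?thesis by blast
qed

text \<open>The error factor \<open>e = 2 ^ Suc (card K) - 1\<close> satisfies \<open>e' = 2 e + 1\<close> when \<open>K\<close> grows by one element:
  two applications of the induction hypothesis and one error from the sieve step.\<close>

lemma new_mass_estimate:
  "\<exists>C\<ge>0. \<forall>K n. finite K \<longrightarrow> n > 0 \<longrightarrow> (\<forall>q\<in>K. prime q \<and> q dvd n) \<longrightarrow>
     abs (new_mass K n - ln (abs alpha) * n * (\<Prod>q\<in>K. 1 - 1 / real q))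
       \<le> (2 ^ Suc (card K) - 1) * (ln (real n) + C)"
proof -
  obtain C1 where C1: "C1 \<ge> 0" "\<And>n. n > 0 \<Longrightarrow>
      abs (ln (abs (real_of_int (U n))) - real n * ln (abs alpha)) \<le> C1"
    using ln_abs_U by blast
  obtain C2 where C2: "C2 \<ge> 0" "\<And>K m q. m > 0 \<Longrightarrow> prime q \<Longrightarrow> q \<notin> K \<Longrightarrow> (\<forall>r\<in>K. prime r \<and> r dvd m) \<Longrightarrow>
     new_mass K m \<le> new_mass K (m * q) - new_mass (insert q K) (m * q) \<and>
     new_mass K (m * q) - new_mass (insert q K) (m * q) \<le> new_mass K m + ln (real q) + C2"
    using new_mass_step by blast
  define C L where "C = C1 + C2" and "L = ln (abs alpha)"
  have "abs (new_mass K n - L * n * (\<Prod>q\<in>K. 1 - 1 / real q))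
       \<le> (2 ^ Suc (card K) - 1) * (ln (real n) + C)"
    if "finite K" "n > 0" "\<forall>q\<in>K. prime q \<and> q dvd n" for K n
    using that
  proof (induction K arbitrary: n rule: finite_induct)
    case empty
    have "abs (new_mass {} n - L * n * 1) \<le> C1"
      using C1(2)[of n] empty by (simp add: new_mass_empty L_def mult.commute)
    moreover have "ln (real n) \<ge> 0" using empty by simp
    then have "C1 \<le> ln (real n) + C" using C2(1) unfolding C_def by linarith
    ultimately show ?case by simp
  next
    case (insert q K)
    define w where "w = (\<Prod>q\<in>K. 1 - 1 / real q)"
    define e where "e = (2 ^ Suc (card K) - 1 :: real)"
    have q: "prime q" "q > 0" using insert.prems prime_gt_0_nat by auto
    obtain m where m: "n = m * q" using insert.prems by (metis dvdE insertI1 mult.commute)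
    have m0: "m > 0" using insert.prems m by auto
    have K: "prime r \<and> r dvd m" if "r \<in> K" for r
    proof -
      have r: "prime r" "r dvd m * q" using that insert.prems m by auto
      moreover have "\<not> r dvd q" using that insert.hyps q r by (metis primes_dvd_imp_eq)
      ultimately show ?thesis by (auto simp: prime_dvd_mult_iff)
    qed
    have "abs (new_mass K n - L * n * w) \<le> e * (ln (real n) + C)"
      using insert.IH[of n] insert.prems by (simp add: w_def e_def)
    moreover have "abs (new_mass K m - L * m * w) \<le> e * (ln (real m) + C)"
      using insert.IH[of m] m0 K by (simp add: w_def e_def)
    moreover have "e * (ln (real m) + C) \<le> e * (ln (real n) + C)"
      using m m0 q one_le_power[of "2 :: real" "Suc (card K)"] by (intro mult_left_mono) (auto simp: e_def)
    moreover have "new_mass K m \<le> new_mass K n - new_mass (insert q K) n"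
      "new_mass K n - new_mass (insert q K) n \<le> new_mass K m + ln (real q) + C2"
      using C2(2)[OF m0 q(1) insert.hyps(2)] K m by auto
    moreover have "ln (real q) \<le> ln (real n)" "ln (real q) \<ge> 0" using m m0 q by auto
    moreover have "L * n * (\<Prod>q\<in>insert q K. 1 - 1 / real q) = L * n * w - L * m * w"
      using insert.hyps q by (simp add: w_def m field_simps)
    moreover have "(2 ^ Suc (card (insert q K)) - 1) * (ln (real n) + C)
        = 2 * (e * (ln (real n) + C)) + (ln (real n) + C)"
      using insert.hyps by (simp add: e_def algebra_simps)
    ultimately show ?case using C1(1) by (simp only: abs_le_iff C_def) linarith
  qed
  moreover have "C \<ge> 0" using C1(1) C2(1) by (simp add: C_def)
  ultimately show ?thesis unfolding L_def by blast
qed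

lemma primitive_if_new:
  assumes "n > 0" "p \<in> new_primes (prime_factors n) n"
  shows "primitive_prime_divisor P Q n p"
proof -
  have p: "prime p" "p dvd U n" "\<And>q. q \<in> prime_factors n \<Longrightarrow> \<not> p dvd U (n div q)"
    using assms by (auto simp: new_primes_def)
  have "\<not> p dvd U m" if m: "1 \<le> m" "m < n" for m
  proof
    assume "p dvd U m"
    then have "p dvd U (gcd m n)" using p prime_dvd_U_gcd by blast
    obtain k where k: "n = gcd m n * k" by (meson dvdE gcd_dvd2)
    have "gcd m n \<le> m" using m by (intro gcd_le1_nat) auto
    then have "gcd m n \<noteq> n" using m by linarith
    then have "k \<noteq> 1" using k by (metis mult.right_neutral)
    then obtain q where q: "prime q" "q dvd k" using prime_factor_nat by blast
    then obtain j where j: "k = q * j" by blast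
    have "n div q = gcd m n * j"
      using k j q prime_gt_0_nat[of q] by (metis mult.left_commute nonzero_mult_div_cancel_left not_gr_zero)
    then have "p dvd U (n div q)" using \<open>p dvd U (gcd m n)\<close> U_dvd_U_mult dvd_trans by metis
    moreover have "q \<in> prime_factors n"
      using assms(1) q k by (metis dvd_mult in_prime_factors_iff not_gr_zero)
    ultimately show False using p by blast
  qed
  then show ?thesis using p by (simp add: primitive_prime_divisor_def)
qed

end

section \<open>A lower bound for the main term\<close>

text \<open>Factors with \<open>q \<ge> 6\<close> are at least \<open>1\<close>; the others are at least \<open>1/4\<close>, and there are at most
  \<open>6\<close> of them by the crude count of the numbers below \<open>6\<close>.\<close>

lemma prod_prime_sieve_lower_bound:
  fixes K :: "nat set"
  assumes "finite K" and "\<And>q. q \<in> K \<Longrightarrow> prime q"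
  shows "(\<Prod>q\<in>K. sqrt (real q) * ((1 - 1 / real q) / 2)) \<ge> (1 / 4) ^ 6"
proof -
  define f where "f q = sqrt (real q) * ((1 - 1 / real q) / 2)" for q :: nat
  have small: "f q \<ge> 1 / 4" if "q \<in> K" for q
  proof -
    have q: "real q \<ge> 2" using assms(2)[OF that] prime_ge_2_nat[of q] by simp
    then have "1 * (1 / 4) \<le> sqrt (real q) * ((1 - 1 / real q) / 2)"
      by (intro mult_mono) (auto simp: field_simps)
    then show ?thesis by (simp add: f_def)
  qed
  have large: "f q \<ge> 1" if "q \<ge> 6" for q
  proof -
    have q: "real q \<ge> 6" using that by simp
    then have "6 * real q \<le> real q * real q" by (intro mult_right_mono) auto
    then have "4 * real q \<le> (real q - 1)\<^sup>2" by (simp add: power2_eq_square algebra_simps)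
    then have "sqrt (4 * real q) \<le> real q - 1" using q by (intro real_le_lsqrt) auto
    then have "2 * sqrt (real q) \<le> real q - 1" by (simp add: real_sqrt_mult)
    then have "2 * sqrt (real q) * sqrt (real q) \<le> (real q - 1) * sqrt (real q)"
      by (intro mult_right_mono) auto
    then have "2 * real q \<le> (real q - 1) * sqrt (real q)" using q by (simp add: mult.assoc)
    then show ?thesis using q by (simp add: f_def field_simps)
  qed
  have "card (K \<inter> {..<6}) \<le> card {..<6::nat}" by (intro card_mono) auto
  then have "(1 / 4 :: real) ^ 6 \<le> (1 / 4) ^ card (K \<inter> {..<6})"
    by (intro power_decreasing) auto
  also have "\<dots> \<le> (\<Prod>q\<in>K \<inter> {..<6}. f q)"
    using small prod_mono[of "K \<inter> {..<6}" "\<lambda>_. 1 / 4 :: real" f] by auto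
  also have "\<dots> \<le> (\<Prod>q\<in>K \<inter> {..<6}. f q) * (\<Prod>q\<in>K - {..<6}. f q)"
  proof -
    have "(\<Prod>q\<in>K \<inter> {..<6}. f q) \<ge> 0" using small by (intro prod_nonneg) force
    moreover have "(\<Prod>q\<in>K - {..<6}. f q) \<ge> 1" using large by (intro prod_ge_1) auto
    ultimately show ?thesis by (simp add: mult_le_cancel_left1)
  qed
  also have "\<dots> = (\<Prod>q\<in>K. f q)" using prod.Int_Diff[OF assms(1), of f "{..<6}"] by simp
  finally show ?thesis by (simp add: f_def)
qed

text \<open>The left-hand side is Euler's totient of \<open>n\<close>. The bound follows from the previous one because
  \<open>\<surd>n\<close> is at least the product of \<open>\<surd>q\<close> over the prime factors \<open>q\<close> of \<open>n\<close>.\<close>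

lemma totient_product_lower_bound:
  assumes "n > 0"
  shows "real n * (\<Prod>q\<in>prime_factors n. 1 - 1 / real q)
           \<ge> (1 / 4) ^ 6 * 2 ^ card (prime_factors n) * sqrt (real n)"
proof -
  define K where "K = prime_factors n"
  have "(\<Prod>q\<in>K. q) dvd (\<Prod>q\<in>K. q ^ multiplicity q n)"
    using assms by (intro prod_dvd_prod) (auto simp: K_def prime_factors_multiplicity dvd_power)
  also have "\<dots> = n" using assms by (simp add: K_def prod_prime_factors)
  finally have "(\<Prod>q\<in>K. q) \<le> n" using assms by (simp add: dvd_imp_le)
  then have "real (\<Prod>q\<in>K. q) \<le> real n" by (simp only: of_nat_le_iff)
  then have "(\<Prod>q\<in>K. real q) \<le> real n" by (simp only: of_nat_prod)
  then have "sqrt (\<Prod>q\<in>K. real q) \<le> sqrt (real n)" by (rule real_sqrt_le_mono)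
  moreover have "sqrt (\<Prod>q\<in>K. real q) = (\<Prod>q\<in>K. sqrt (real q))"
    by (induction K rule: infinite_finite_induct) (auto simp: real_sqrt_mult)
  ultimately have sq: "(\<Prod>q\<in>K. sqrt (real q)) \<le> sqrt (real n)" by simp
  define w where "w = (\<Prod>q\<in>K. (1 - 1 / real q) / 2)"
  have w: "w \<ge> 0"
    unfolding w_def using prime_gt_0_nat by (intro prod_nonneg) (force simp: K_def field_simps)
  have "(1 / 4) ^ 6 \<le> (\<Prod>q\<in>K. sqrt (real q)) * w"
    using prod_prime_sieve_lower_bound[of K] unfolding w_def prod.distrib[symmetric]
    by (simp add: K_def in_prime_factors_iff)
  also have "\<dots> \<le> sqrt (real n) * w" using sq w by (rule mult_right_mono)
  finally have "(1 / 4) ^ 6 * sqrt (real n) \<le> (sqrt (real n) * w) * sqrt (real n)"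
    by (intro mult_right_mono) auto
  also have "\<dots> = real n * w" by simp
  finally have "2 ^ card K * ((1 / 4) ^ 6 * sqrt (real n)) \<le> 2 ^ card K * (real n * w)"
    by (intro mult_left_mono) auto
  also have "\<dots> = real n * (\<Prod>q\<in>K. 1 - 1 / real q)"
    by (simp add: w_def prod_dividef)
  finally show ?thesis by (simp add: K_def mult_ac)
qed

section \<open>Primitive divisors and coprime product solutions\<close>

context unit_lucas
begin

theorem eventually_primitive_prime_divisor:
  "\<forall>\<^sub>F n in sequentially. \<exists>p. primitive_prime_divisor P Q n p"
proof -
  define L where "L = ln (abs alpha)"
  have L: "L > 0" using abs_alpha_gt_1 by (simp add: L_def)
  obtain C where C: "C \<ge> 0" "\<And>K n. finite K \<Longrightarrow> n > 0 \<Longrightarrow> (\<forall>q\<in>K. prime q \<and> q dvd n) \<Longrightarrow>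
     abs (new_mass K n - L * n * (\<Prod>q\<in>K. 1 - 1 / real q))
       \<le> (2 ^ Suc (card K) - 1) * (ln (real n) + C)"
    using new_mass_estimate unfolding L_def by blast
  define a where "a = L * (1 / 4) ^ 6"
  have "a > 0" using L by (simp add: a_def)
  then have "\<forall>\<^sub>F n in sequentially. 2 * (ln (real n) + C) < a * sqrt (real n)"
    by real_asymp
  then show ?thesis
    using eventually_gt_at_top[of 0]
  proof eventually_elim
    case (elim n)
    define K where "K = prime_factors n"
    have "2 ^ Suc (card K) * (ln (real n) + C) < 2 ^ card K * (a * sqrt (real n))"
      using elim by simp
    also have "\<dots> \<le> L * (real n * (\<Prod>q\<in>K. 1 - 1 / real q))"
      using mult_left_mono[OF totient_product_lower_bound[OF elim(2)], of L] L
      by (simp add: K_def a_def mult_ac)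
    also have "\<dots> \<le> new_mass K n + (2 ^ Suc (card K) - 1) * (ln (real n) + C)"
      using C(2)[of K n] elim(2) by (simp add: K_def in_prime_factors_iff abs_le_iff mult.assoc)
    finally have "new_mass K n > ln (real n) + C" by (simp add: algebra_simps)
    moreover have "ln (real n) \<ge> 0" using elim(2) by simp
    ultimately have "new_mass K n \<noteq> 0" using C(1) by linarith
    then obtain p where "p \<in> new_primes K n" unfolding new_mass_def by (metis sum.empty ex_in_conv)
    then show ?case using primitive_if_new[OF elim(2)] by (auto simp: K_def)
  qed
qed

lemma primitive_divisor_index_in_Z_set:
  assumes "primitive_prime_divisor P Q n p" "p dvd A" "n > 0"
  shows "n \<in> Z_set P Q A"
proof -
  have "rank_of_apparition P Q p = n"
    unfolding rank_of_apparition_def using assms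
    by (intro Least_equality) (auto simp: primitive_prime_divisor_def not_less[symmetric])
  moreover have "has_rank P Q p"
    using assms by (auto simp: primitive_prime_divisor_def has_rank_def intro!: exI[of _ n])
  ultimately show ?thesis using assms by (auto simp: Z_set_def primitive_prime_divisor_def)
qed

text \<open>The factor \<open>U n\<close> is the only one divisible by \<open>p\<close>, so \<open>multiplicity p (U n)\<close> is even.\<close>

lemma coprime_product_multiplicity:
  assumes sol: "coprime_product_solution P Q A y ns" and n: "n \<in> set ns"
    and p: "prime p" "p dvd U n" "\<not> p dvd A"
  shows "multiplicity p (U n) \<ge> 2"
proof -
  obtain i where i: "i < length ns" "ns ! i = n" using n by (auto simp: in_set_conv_nth)
  have prod: "A * y ^ 2 = (\<Prod>j<length ns. U (ns ! j))"
    and pos: "\<And>j. j < length ns \<Longrightarrow> ns ! j > 0"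
    and cop: "\<And>j. j < length ns \<Longrightarrow> j \<noteq> i \<Longrightarrow> gcd (ns ! j) n = 1"
    using sol i by (auto simp: coprime_product_solution_def)
  have nz: "U (ns ! j) \<noteq> 0" if "j < length ns" for j using U_nonzero[OF pos[OF that]] .
  then have "A * y ^ 2 \<noteq> 0" unfolding prod by simp
  then have Ay: "A \<noteq> 0" "y \<noteq> 0" by auto
  have zero: "multiplicity p (U (ns ! j)) = 0" if "j < length ns" "j \<noteq> i" for j
  proof (rule not_dvd_imp_multiplicity_0, rule notI)
    assume "p dvd U (ns ! j)"
    then have "p dvd U 1" using prime_dvd_U_gcd[of p "ns ! j" n] p cop[OF that] by simp
    then show False using p by (auto dest: not_prime_unit)
  qed
  have pe: "prime_elem p" using p(1) by (rule prime_imp_prime_elem)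
  have "2 * multiplicity p y = multiplicity p (A * y ^ 2)"
    using prime_elem_multiplicity_mult_distrib[OF pe, of A "y ^ 2"]
      prime_elem_multiplicity_power_distrib[OF pe, of y 2] Ay p not_dvd_imp_multiplicity_0[of p A]
    by simp
  also have "\<dots> = (\<Sum>j<length ns. multiplicity p (U (ns ! j)))"
    unfolding prod using nz by (subst prime_elem_multiplicity_prod_distrib[OF pe]) auto
  also have "\<dots> = multiplicity p (U n)"
    using i zero by (subst sum.remove[of _ i]) auto
  finally have "even (multiplicity p (U n))" by (metis dvd_triv_left)
  moreover have "multiplicity p (U n) > 0"
    using p nz[OF i(1)] i(2) by (auto simp: prime_multiplicity_gt_zero_iff)
  ultimately show ?thesis by presburger
qed

end

lemma lucas_nondegenerate_P_nonzero:
  assumes "Q = 1 \<or> Q = -1" "P ^ 2 + 4 * Q > 0" "lucas_nondegenerate P Q"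
  shows "P \<noteq> 0"
proof
  assume P: "P = 0"
  then have "Q = 1" using assms by auto
  then have "lucas_roots P Q 1 (-1)" using P by (simp add: lucas_roots_def)
  moreover have "root_of_unity (1 / (-1))" unfolding root_of_unity_def by (intro exI[of _ 2]) simp
  ultimately show False using assms(3) unfolding lucas_nondegenerate_def by blast
qed

theorem corollary6p6:
  fixes P Q :: int
  assumes "Q = 1 \<or> Q = -1"
    and "P ^ 2 + 4 * Q > 0"
    and "lucas_nondegenerate P Q"
  shows "\<exists>N\<^sub>0 :: nat. \<forall>(A :: int) (y :: int) (ns :: nat list) (n :: nat).
           A \<noteq> 0 \<longrightarrow> n > N\<^sub>0 \<longrightarrow> n \<notin> Z_set P Q A \<longrightarrow>
           coprime_product_solution P Q A y ns \<longrightarrow> n \<in> set ns \<longrightarrow>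
             (\<exists>p. primitive_prime_divisor P Q n p \<and> \<not> p dvd A) \<and>
             (\<forall>p. primitive_prime_divisor P Q n p \<and> \<not> p dvd A
                \<longrightarrow> multiplicity p (lucas_U P Q n) \<ge> 2)"
proof -
  interpret unit_lucas P Q
    using assms lucas_nondegenerate_P_nonzero by unfold_locales auto
  obtain N where N: "\<And>n. n \<ge> N \<Longrightarrow> \<exists>p. primitive_prime_divisor P Q n p"
    using eventually_primitive_prime_divisor by (auto simp: eventually_sequentially)
  show ?thesis
  proof (intro exI[of _ N] allI impI conjI)
    fix A y :: int and ns :: "nat list" and n :: nat
    assume n: "n > N" "n \<notin> Z_set P Q A"
    then show "\<exists>p. primitive_prime_divisor P Q n p \<and> \<not> p dvd A"
      using N[of n] primitive_divisor_index_in_Z_set[of n _ A] by auto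
  next
    fix A y :: int and ns :: "nat list" and n :: nat and p :: int
    assume "coprime_product_solution P Q A y ns" "n \<in> set ns"
      "primitive_prime_divisor P Q n p \<and> \<not> p dvd A"
    then show "multiplicity p (lucas_U P Q n) \<ge> 2"
      using coprime_product_multiplicity by (auto simp: primitive_prime_divisor_def)
  qed
qed

end
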